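(* Let $X$ be a locally compact Hausdorff space and let $k$ be a nonnegative symmetric kernel on $X$. If the kernel $k$ is continuous (and real-valued) and $L\subset X$ is compact, then $R(H,L)=A(H,L)$ for all $H\subset X$.
   Context: "Continuous kernel" means that $k$ is a continuous function $X\times X\to[0,+\infty)$, with $k(x,y)=k(y,x)$ for all $x,y\in X$. $\mathfrak{M}_1(X)$ is the set of regular Borel probability measures on $X$; each such $\mu$ is identified with its Carathéodory extension to an outer measure. For an arbitrary set $H\subset X$, $\mathfrak{M}_1(H)$ is the set of those $\mu\in\mathfrak{M}_1(X)$ that are concentrated on $H$, i.e. every compact set meets $X\setminus H$ in a set of outer $\mu$-measure zero (equivalently, since $\mu$ is finite, $H$ is $\mu$-measurable in the Carathéodory sense and $\mu(H)=1$). The potential of $\mu$ is $U^\mu(x)=\int_X k(x,y)\,d\mu(y)\in[0,+\infty]$. For $E\subset[0,+\infty]$, $\overline{\mathrm{conv}}\,E$ denotes the closed convex hull of $E$ in $[0,+\infty]$ (compact, with its usual topology). For $H,L\subset X$ define $$R(H,L)=\bigcap_{n=1}^\infty\ \bigcap_{w_1,\dots,w_n\in H}\overline{\mathrm{conv}}\Big\{\tfrac1n\sum_{j=1}^n k(x,w_j): x\in L\Big\},\qquad A(H,L)=\bigcap_{\mu\in\mathfrak{M}_1(H)}\overline{\mathrm{conv}}\{U^\mu(x): x\in L\}.$$ The points $w_1,\dots,w_n$ need not be distinct. All these are (possibly empty) subsets of $[0,+\infty]$; an intersection over an empty family is $[0,+\infty]$. *)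

theory Defs
  imports "HOL-Probability.Probability"
begin

definition continuous_kernel :: "('a::topological_space \<Rightarrow> 'a \<Rightarrow> real) \<Rightarrow> bool" where
  "continuous_kernel k \<longleftrightarrow>
     (\<forall>x y. 0 \<le> k x y) \<and> (\<forall>x y. k x y = k y x) \<and>
     continuous_on UNIV (\<lambda>(x, y). k x y)"

definition regular_borel_prob :: "('a::topological_space) measure \<Rightarrow> bool" where
  "regular_borel_prob \<mu> \<longleftrightarrow>
     sets \<mu> = sets borel \<and> prob_space \<mu> \<and>
     (\<forall>B\<in>sets \<mu>. emeasure \<mu> B = (SUP K\<in>{K. compact K \<and> K \<subseteq> B}. emeasure \<mu> K)) \<and>
     (\<forall>B\<in>sets \<mu>. emeasure \<mu> B = (INF U\<in>{U. open U \<and> B \<subseteq> U}. emeasure \<mu> U))"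

(* outer_measure_of is the Caratheodory extension of \<mu> to all subsets; the set H, and
   hence K - H, need not be Borel. *)
definition concentrated_on :: "('a::topological_space) measure \<Rightarrow> 'a set \<Rightarrow> bool" where
  "concentrated_on \<mu> H \<longleftrightarrow> (\<forall>K. compact K \<longrightarrow> outer_measure_of \<mu> (K - H) = 0)"

definition prob_measures_on :: "('a::topological_space) set \<Rightarrow> 'a measure set" where
  "prob_measures_on H = {\<mu>. regular_borel_prob \<mu> \<and> concentrated_on \<mu> H}"

definition potential :: "('a \<Rightarrow> 'a \<Rightarrow> real) \<Rightarrow> 'a measure \<Rightarrow> 'a \<Rightarrow> ennreal" where
  "potential k \<mu> x = (\<integral>\<^sup>+ y. ennreal (k x y) \<partial>\<mu>)"

(* Convexity in [0,\<infinity>] means containing, with any two points, the whole segment between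
   them, where the segment from x to \<infinity> is {x..\<infinity>}.  Algebraic convex combinations would not
   do: (1 - t) * x + t * \<infinity> takes only the values x and \<infinity> for t in [0,1]. *)
definition ennreal_convex :: "ennreal set \<Rightarrow> bool" where
  "ennreal_convex C \<longleftrightarrow> (\<forall>x\<in>C. \<forall>y\<in>C. {x..y} \<subseteq> C)"

definition closed_conv :: "ennreal set \<Rightarrow> ennreal set" where
  "closed_conv E = \<Inter>{C. closed C \<and> ennreal_convex C \<and> E \<subseteq> C}"

definition R_set :: "('a \<Rightarrow> 'a \<Rightarrow> real) \<Rightarrow> 'a set \<Rightarrow> 'a set \<Rightarrow> ennreal set" where
  "R_set k H L =
     (\<Inter>n\<in>{1..}. \<Inter>w\<in>{w :: nat \<Rightarrow> 'a. \<forall>j\<in>{1..n}. w j \<in> H}.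
        closed_conv ((\<lambda>x. ennreal (1 / real n * (\<Sum>j=1..n. k x (w j)))) ` L))"

definition A_set :: "('a::topological_space \<Rightarrow> 'a \<Rightarrow> real) \<Rightarrow> 'a set \<Rightarrow> 'a set \<Rightarrow> ennreal set" where
  "A_set k H L = (\<Inter>\<mu>\<in>prob_measures_on H. closed_conv (potential k \<mu> ` L))"

end

theory Submission
  imports Defs
begin

text \<open>
  Since a closed convex hull in \<open>[0,\<infinity>]\<close> of a nonempty set is the interval between its infimum
  and its supremum, only lower and upper bounds of potentials on \<open>L\<close> matter. Averages of point
  masses are regular probability measures, which gives \<open>A(H,L) \<subseteq> R(H,L)\<close>. Conversely, a measure
  \<open>\<mu>\<close> concentrated on \<open>H\<close> is restricted to a large compact set \<open>K\<close> and normalised. The kernel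
  has small oscillation, uniformly in \<open>x \<in> L\<close>, on the pieces of a finite Borel partition of \<open>K\<close>;
  every piece of positive measure meets \<open>H\<close>, so one point of \<open>H\<close> per piece, repeated according
  to the rounded weights, gives averages uniformly close on \<open>L\<close> to the normalised potential.
  Normalising only increases the potential of the restriction, so this is harmless for lower
  bounds; for upper bounds one uses \<open>\<mu>(K) \<rightarrow> 1\<close>.
\<close>

section \<open>Closed convex hulls in the extended half-line\<close>

text \<open>The interval is itself one of the closed convex sets being intersected. For empty
  \<open>E\<close> it runs from top to bottom, hence is empty; this settles the case of an empty
  \<open>L\<close> later.\<close>

lemma closed_conv_subset_Inf_Sup: "closed_conv E \<subseteq> {Inf E..Sup E}"
  unfolding closed_conv_def
  by (rule Inter_lower) (auto simp: ennreal_convex_def Inf_lower Sup_upper intro: order_trans)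

text \<open>A nonempty closed set \<open>C\<close> in a complete linear order contains its infimum
  and supremum, so convexity gives it the whole interval between them.\<close>

lemma closed_conv_eq_Inf_Sup:
  assumes "E \<noteq> {}"
  shows "closed_conv E = {Inf E..Sup E}"
proof (rule antisym[OF closed_conv_subset_Inf_Sup])
  show "{Inf E..Sup E} \<subseteq> closed_conv E"
    unfolding closed_conv_def
  proof (rule Inter_greatest)
    fix C assume "C \<in> {C. closed C \<and> ennreal_convex C \<and> E \<subseteq> C}"
    then have C: "closed C" "ennreal_convex C" "E \<subseteq> C" by auto
    have "Inf C \<in> C" "Sup C \<in> C"
      using C assms by (auto intro!: closed_contains_Inf_cl closed_contains_Sup_cl)
    then have "{Inf C..Sup C} \<subseteq> C" using C(2) unfolding ennreal_convex_def by blast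
    moreover have "Inf C \<le> Inf E" "Sup E \<le> Sup C"
      using C(3) by (auto intro: Inf_superset_mono Sup_subset_mono)
    ultimately show "{Inf E..Sup E} \<subseteq> C" by (meson atLeastatMost_subset_iff order_trans)
  qed
qed

section \<open>Finite averages\<close>

text \<open>Integer weights become repetitions: take \<open>m i\<close> labelled copies of each
  \<open>i\<close>, enumerate them all from 1, and forget the labels.\<close>

lemma sum_weights_as_sequence:
  fixes m :: "'i \<Rightarrow> nat"
  assumes "finite I"
  obtains g where "\<And>j. j \<in> {1..(\<Sum>i\<in>I. m i)} \<Longrightarrow> g j \<in> I"
    "\<And>f :: 'i \<Rightarrow> real. (\<Sum>j=1..(\<Sum>i\<in>I. m i). f (g j)) = (\<Sum>i\<in>I. real (m i) * f i)"
proof -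
  let ?S = "Sigma I (\<lambda>i. {..<m i})"
  have fin: "finite ?S" and card: "card ?S = (\<Sum>i\<in>I. m i)" using assms by auto
  obtain h where h: "bij_betw h {1..(\<Sum>i\<in>I. m i)} ?S"
    using ex_bij_betw_nat_finite_1[OF fin] card by auto
  show ?thesis
  proof (rule that[of "fst \<circ> h"])
    show "(fst \<circ> h) j \<in> I" if "j \<in> {1..(\<Sum>i\<in>I. m i)}" for j
      using bij_betwE[OF h] that by fastforce
    show "(\<Sum>j=1..(\<Sum>i\<in>I. m i). f ((fst \<circ> h) j)) = (\<Sum>i\<in>I. real (m i) * f i)" for f :: "'i \<Rightarrow> real"
    proof -
      have "(\<Sum>j=1..(\<Sum>i\<in>I. m i). f (fst (h j))) = (\<Sum>s\<in>?S. f (fst s))"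
        by (rule sum.reindex_bij_betw[OF h])
      also have "\<dots> = (\<Sum>i\<in>I. \<Sum>l<m i. f i)"
        using sum.Sigma[of I "\<lambda>i. {..<m i}" "\<lambda>i _. f i"] assms by (simp add: split_beta)
      finally show ?thesis by simp
    qed
  qed
qed

text \<open>Real weights are rounded to multiples of \<open>1 / n\<close>. The choice of
  \<open>n\<close> and \<open>g\<close> precedes that of \<open>f\<close>, so one sequence serves
  all functions bounded by \<open>M\<close>; this yields uniformity over \<open>L\<close>
  later.\<close>

lemma weighted_average_approx:
  fixes p :: "'i \<Rightarrow> real"
  assumes fin: "finite I" and p: "\<And>i. i \<in> I \<Longrightarrow> 0 \<le> p i" "(\<Sum>i\<in>I. p i) = 1"
    and "0 < e" "0 \<le> M"
  obtains n :: nat and g where "1 \<le> n" "\<And>j. j \<in> {1..n} \<Longrightarrow> g j \<in> I"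
    "\<And>f :: 'i \<Rightarrow> real. (\<And>i. i \<in> I \<Longrightarrow> \<bar>f i\<bar> \<le> M) \<Longrightarrow>
       \<bar>1 / real n * (\<Sum>j=1..n. f (g j)) - (\<Sum>i\<in>I. p i * f i)\<bar> \<le> e"
proof -
  have "I \<noteq> {}" using p(2) by auto
  then obtain i0 where i0: "i0 \<in> I" by auto
  \<comment> \<open>Rounding down and reassigning the lost mass each cost at most
    \<open>card I * M\<close> before division by \<open>n\<close>.\<close>
  obtain n0 :: nat where n0: "2 * real (card I) * M / e < real n0" using reals_Archimedean2 by blast
  define n where "n = Suc n0"
  have n: "1 \<le> n" "2 * real (card I) * M \<le> e * real n"
    using n0 \<open>0 < e\<close> by (auto simp: n_def field_simps)
  define q where "q i = nat \<lfloor>real n * p i\<rfloor>" for i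
  have q: "real (q i) \<le> real n * p i" "real n * p i - 1 \<le> real (q i)" if "i \<in> I" for i
    using p(1)[OF that] by (auto simp: q_def)
  have sumnp: "(\<Sum>i\<in>I. real n * p i) = real n" using p(2) by (simp flip: sum_distrib_left)
  have "(\<Sum>i\<in>I. real (q i)) \<le> real n" using sum_mono[of I "\<lambda>i. real (q i)" "\<lambda>i. real n * p i"] q sumnp by auto
  then have qn: "sum q I \<le> n" by (simp flip: of_nat_sum)
  \<comment> \<open>the mass lost by rounding down is put on an arbitrary index \<open>i0\<close>\<close>
  define r where "r = n - sum q I"
  have "(\<Sum>i\<in>I. real n * p i - 1) \<le> (\<Sum>i\<in>I. real (q i))" by (rule sum_mono) (use q in auto)
  then have r: "real r \<le> real (card I)" using qn sumnp by (simp add: r_def sum_subtractf of_nat_diff)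
  define m where "m i = q i + (if i = i0 then r else 0)" for i
  have m: "sum m I = n" using qn fin i0 by (simp add: m_def sum.distrib r_def)
  obtain g where g: "\<And>j. j \<in> {1..n} \<Longrightarrow> g j \<in> I"
    "\<And>f :: 'i \<Rightarrow> real. (\<Sum>j=1..n. f (g j)) = (\<Sum>i\<in>I. real (m i) * f i)"
    using sum_weights_as_sequence[OF fin, of m] unfolding m by metis
  show ?thesis
  proof (rule that[OF n(1) g(1)])
    fix f :: "'i \<Rightarrow> real" assume f: "\<And>i. i \<in> I \<Longrightarrow> \<bar>f i\<bar> \<le> M"
    have split: "(\<Sum>j=1..n. f (g j)) = (\<Sum>i\<in>I. real (q i) * f i) + real r * f i0"
    proof -
      have "(\<Sum>i\<in>I. real (m i) * f i) = (\<Sum>i\<in>I. real (q i) * f i + (if i = i0 then real r * f i0 else 0))"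
        by (rule sum.cong) (auto simp: m_def algebra_simps)
      then show ?thesis using fin i0 g(2)[of f] by (simp add: sum.distrib del: One_nat_def)
    qed
    have "\<bar>(\<Sum>i\<in>I. real (q i) * f i) - (\<Sum>i\<in>I. (real n * p i) * f i)\<bar> \<le> (\<Sum>i\<in>I. \<bar>real (q i) * f i - (real n * p i) * f i\<bar>)"
      by (simp flip: sum_subtractf)
    also have "\<dots> \<le> (\<Sum>i\<in>I. M)"
    proof (rule sum_mono)
      fix i assume "i \<in> I"
      have "\<bar>(real (q i) - real n * p i) * f i\<bar> \<le> 1 * M"
        unfolding abs_mult using q[OF \<open>i \<in> I\<close>] f[OF \<open>i \<in> I\<close>] by (intro mult_mono) auto
      then show "\<bar>real (q i) * f i - (real n * p i) * f i\<bar> \<le> M" by (simp add: algebra_simps)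
    qed
    finally have 1: "\<bar>(\<Sum>i\<in>I. real (q i) * f i) - (\<Sum>i\<in>I. (real n * p i) * f i)\<bar> \<le> real (card I) * M"
      by simp
    have 2: "\<bar>real r * f i0\<bar> \<le> real (card I) * M"
      unfolding abs_mult using r f[OF i0] by (intro mult_mono) auto
    have "(\<Sum>i\<in>I. (real n * p i) * f i) = real n * (\<Sum>i\<in>I. p i * f i)"
      by (simp add: sum_distrib_left mult.assoc)
    then have "\<bar>(\<Sum>j=1..n. f (g j)) - real n * (\<Sum>i\<in>I. p i * f i)\<bar> \<le> e * real n"
      using 1 2 n(2) split by linarith
    then have "\<bar>(\<Sum>j=1..n. f (g j)) - real n * (\<Sum>i\<in>I. p i * f i)\<bar> / real n \<le> e"
      using n(1) by (simp add: field_simps)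
    moreover have "\<bar>(\<Sum>j=1..n. f (g j)) - real n * (\<Sum>i\<in>I. p i * f i)\<bar> / real n
        = \<bar>((\<Sum>j=1..n. f (g j)) - real n * (\<Sum>i\<in>I. p i * f i)) / real n\<bar>"
      by simp
    ultimately show "\<bar>1 / real n * (\<Sum>j=1..n. f (g j)) - (\<Sum>i\<in>I. p i * f i)\<bar> \<le> e"
      using n(1) by (simp add: diff_divide_distrib)
  qed
qed

section \<open>Discrete measures\<close>

lemma measurable_uniform_count_measure:
  "f \<in> measurable (uniform_count_measure A) M \<longleftrightarrow> f ` A \<subseteq> space M"
  by (auto simp: measurable_def sets_uniform_count_measure space_uniform_count_measure)

text \<open>This is the average of the point masses at \<open>w 1\<close>, ..., \<open>w n\<close>,
  counted with repetition. It lives on the finite set \<open>?W\<close>, so regularity reduces to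
  finite sets being compact and closed.\<close>

lemma uniform_distr_prob_measure:
  notes [simp del] = One_nat_def
  fixes w :: "nat \<Rightarrow> 'a::t2_space"
  assumes n: "1 \<le> n" and w: "\<And>j. j \<in> {1..n} \<Longrightarrow> w j \<in> H"
  shows "distr (uniform_count_measure {1..n}) borel w \<in> prob_measures_on H" (is "?\<mu> \<in> _")
proof -
  have meas[measurable]: "w \<in> measurable (uniform_count_measure {1..n}) borel"
    by (simp add: measurable_uniform_count_measure)
  have em: "emeasure ?\<mu> B = ennreal (real (card {j\<in>{1..n}. w j \<in> B}) / real n)" if "B \<in> sets borel" for B
  proof -
    have "w -` B \<inter> {1..n} = {j\<in>{1..n}. w j \<in> B}" by auto
    then have "emeasure ?\<mu> B = emeasure (uniform_count_measure {1..n}) {j\<in>{1..n}. w j \<in> B}"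
      using that by (simp add: emeasure_distr space_uniform_count_measure)
    also have "\<dots> = ennreal (real (card {j\<in>{1..n}. w j \<in> B}) / real n)"
      by (subst emeasure_uniform_count_measure) auto
    finally show ?thesis .
  qed
  interpret u: prob_space "uniform_count_measure {1..n}"
    using n by (intro prob_space_uniform_count_measure) auto
  let ?W = "w ` {1..n}"
  have p: "prob_space ?\<mu>" by (rule u.prob_space_distr[OF meas])
  have cl: "closed (?W \<inter> B)" "compact (?W \<inter> B)" for B
    by (auto intro!: finite_imp_closed finite_imp_compact)
  \<comment> \<open>Only the trace on \<open>?W\<close> matters, so a Borel set may be replaced by a
    compact or an open one with the same trace.\<close>
  have em_W: "emeasure ?\<mu> B = emeasure ?\<mu> B'" if "B \<in> sets borel" "B' \<in> sets borel" "?W \<inter> B = ?W \<inter> B'" for B B'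
  proof -
    have "{j\<in>{1..n}. w j \<in> B} = {j\<in>{1..n}. w j \<in> B'}" using that(3) by auto
    then show ?thesis using that em by simp
  qed
  have inner: "emeasure ?\<mu> B = (SUP K\<in>{K. compact K \<and> K \<subseteq> B}. emeasure ?\<mu> K)" if B: "B \<in> sets ?\<mu>" for B
  proof (rule antisym)
    have "emeasure ?\<mu> B = emeasure ?\<mu> (?W \<inter> B)"
      using B cl(1)[of B] by (intro em_W) auto
    also have "\<dots> \<le> (SUP K\<in>{K. compact K \<and> K \<subseteq> B}. emeasure ?\<mu> K)"
      using cl(2)[of B] by (intro SUP_upper) auto
    finally show "emeasure ?\<mu> B \<le> (SUP K\<in>{K. compact K \<and> K \<subseteq> B}. emeasure ?\<mu> K)" .
  qed (use B in \<open>auto intro!: SUP_least emeasure_mono\<close>)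
  have outer: "emeasure ?\<mu> B = (INF U\<in>{U. open U \<and> B \<subseteq> U}. emeasure ?\<mu> U)" if B: "B \<in> sets ?\<mu>" for B
  proof (rule antisym)
    \<comment> \<open>The optimal open superset of \<open>B\<close> omits just the finitely many
      points of \<open>?W\<close> outside \<open>B\<close>.\<close>
    have o: "open (- (?W \<inter> - B))" using cl(1)[of "- B"] by (simp only: open_Compl)
    have "(INF U\<in>{U. open U \<and> B \<subseteq> U}. emeasure ?\<mu> U) \<le> emeasure ?\<mu> (- (?W \<inter> - B))"
      using o by (intro INF_lower) auto
    also have "\<dots> = emeasure ?\<mu> B"
      using B o by (intro em_W) auto
    finally show "(INF U\<in>{U. open U \<and> B \<subseteq> U}. emeasure ?\<mu> U) \<le> emeasure ?\<mu> B" .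
  qed (auto intro!: INF_greatest emeasure_mono)
  have conc: "concentrated_on ?\<mu> H"
    unfolding concentrated_on_def
  proof (intro allI impI)
    fix K :: "'a set"
    have o: "open (- ?W)" using cl(1)[of UNIV] by auto
    \<comment> \<open>\<open>K - H\<close> need not be Borel, but since \<open>?W\<close> lies in
      \<open>H\<close> it is covered by the open null set \<open>- ?W\<close>.\<close>
    have "outer_measure_of ?\<mu> (K - H) \<le> emeasure ?\<mu> (- ?W)"
      unfolding outer_measure_of_def using o w by (intro INF_lower) auto
    also have "\<dots> = emeasure ?\<mu> {}" using o by (intro em_W) auto
    finally show "outer_measure_of ?\<mu> (K - H) = 0" by simp
  qed
  show ?thesis
    unfolding prob_measures_on_def regular_borel_prob_def using p inner outer conc by auto
qed

lemma continuous_kernel_measurable: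
  assumes "continuous_kernel k"
  shows "(\<lambda>y. k x y) \<in> borel_measurable borel"
proof -
  have "continuous_on UNIV ((\<lambda>(x, y). k x y) \<circ> (\<lambda>y. (x, y)))"
    using assms unfolding continuous_kernel_def
    by (intro continuous_on_compose) (auto intro!: continuous_intros elim: continuous_on_subset)
  then show ?thesis by (intro borel_measurable_continuous_onI) (simp add: o_def)
qed

lemma potential_uniform_distr:
  notes [simp del] = One_nat_def
  fixes k :: "'a::t2_space \<Rightarrow> 'a \<Rightarrow> real"
  assumes k: "continuous_kernel k" and n: "1 \<le> n"
  shows "potential k (distr (uniform_count_measure {1..n}) borel w) x
       = ennreal (1 / real n * (\<Sum>j=1..n. k x (w j)))"
proof -
  have [measurable]: "w \<in> measurable (uniform_count_measure {1..n}) borel"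
    by (simp add: measurable_uniform_count_measure)
  have [measurable]: "(\<lambda>y. k x y) \<in> borel_measurable borel"
    by (rule continuous_kernel_measurable[OF k])
  have k0: "0 \<le> k x y" for y using k by (simp add: continuous_kernel_def)
  have "potential k (distr (uniform_count_measure {1..n}) borel w) x
      = (\<integral>\<^sup>+ j. ennreal (k x (w j)) \<partial>uniform_count_measure {1..n})"
    unfolding potential_def by (rule nn_integral_distr) auto
  also have "\<dots> = (\<Sum>j=1..n. ennreal (1 / real n) * ennreal (k x (w j)))"
    unfolding uniform_count_measure_def by (subst nn_integral_point_measure_finite) auto
  also have "\<dots> = ennreal (1 / real n * (\<Sum>j=1..n. k x (w j)))"
    using k0 by (simp add: sum_distrib_left flip: ennreal_mult' sum_ennreal)
  finally show ?thesis .
qed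

text \<open>Every hull in the definition of \<open>R_set\<close> is also one of the hulls
  intersected in \<open>A_set\<close>, namely that of an average of point masses.\<close>

lemma A_set_subset_R_set:
  notes [simp del] = One_nat_def
  fixes k :: "'a::t2_space \<Rightarrow> 'a \<Rightarrow> real"
  assumes k: "continuous_kernel k"
  shows "A_set k H L \<subseteq> R_set k H L"
  unfolding R_set_def
proof (intro INT_greatest)
  fix n :: nat and w :: "nat \<Rightarrow> 'a"
  assume n: "n \<in> {1..}" and w: "w \<in> {w. \<forall>j\<in>{1..n}. w j \<in> H}"
  let ?\<mu> = "distr (uniform_count_measure {1..n}) borel w"
  have "?\<mu> \<in> prob_measures_on H" using n w by (intro uniform_distr_prob_measure) auto
  then have "A_set k H L \<subseteq> closed_conv (potential k ?\<mu> ` L)" unfolding A_set_def by (rule INT_lower)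
  then show "A_set k H L \<subseteq> closed_conv ((\<lambda>x. ennreal (1 / real n * (\<Sum>j=1..n. k x (w j)))) ` L)"
    using n k by (simp add: potential_uniform_distr[OF k])
qed

section \<open>Kernels on compact sets\<close>

lemma continuous_kernel_nonneg: "continuous_kernel k \<Longrightarrow> 0 \<le> k x y"
  and continuous_kernel_sym: "continuous_kernel k \<Longrightarrow> k x y = k y x"
  by (auto simp: continuous_kernel_def)

lemma continuous_kernel_bounded:
  assumes k: "continuous_kernel k" and "compact L" "compact K"
  obtains M where "0 \<le> M" "\<And>x y. x \<in> L \<Longrightarrow> y \<in> K \<Longrightarrow> \<bar>k x y\<bar> \<le> M"
proof -
  have "compact ((\<lambda>(x, y). k x y) ` (L \<times> K))"
    using assms unfolding continuous_kernel_def
    by (intro compact_continuous_image compact_Times) (auto elim: continuous_on_subset)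
  then obtain M where "\<forall>z\<in>(\<lambda>(x, y). k x y) ` (L \<times> K). norm z \<le> M"
    using compact_imp_bounded bounded_iff by metis
  \<comment> \<open>The maximum with 0 covers the case where \<open>L\<close> or \<open>K\<close> is
    empty and \<open>M\<close> could be negative.\<close>
  then show ?thesis by (intro that[of "max 0 M"]) force+
qed

text \<open>A tube lemma: compactness of \<open>K\<close> makes continuity in the first variable at
  \<open>x0\<close> uniform over \<open>y\<close> in \<open>K\<close>.\<close>

lemma continuous_kernel_nbhd:
  assumes k: "continuous_kernel k" and K: "compact K" and "0 < e"
  obtains V where "x0 \<in> V" "open V" "\<And>x y. x \<in> V \<Longrightarrow> y \<in> K \<Longrightarrow> \<bar>k x y - k x0 y\<bar> \<le> e"
proof -
  have "continuous_on (UNIV \<times> K) (\<lambda>(x, y). k x y)"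
    using k unfolding continuous_kernel_def by (auto elim: continuous_on_subset)
  from continuous_on_prod_compactE[OF this K UNIV_I \<open>0 < e\<close>, of x0]
  obtain V where "x0 \<in> V" "open V"
    "\<forall>x\<in>V \<inter> UNIV. \<forall>y\<in>K. dist (case (x, y) of (x, y) \<Rightarrow> k x y) (case (x0, y) of (x, y) \<Rightarrow> k x y) \<le> e"
    by blast
  then show ?thesis by (intro that[of V]) (auto simp: dist_real_def)
qed

lemma small_oscillation_partition:
  fixes k :: "'a::t2_space \<Rightarrow> 'a \<Rightarrow> real"
  assumes k: "continuous_kernel k" and K: "compact K" and L: "compact L" and e: "0 < e"
  obtains N :: nat and B :: "nat \<Rightarrow> 'a set"
  where "disjoint_family B" "(\<Union>i<N. B i) = K" "\<And>i. B i \<in> sets borel"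
    "\<And>i x y y'. x \<in> L \<Longrightarrow> y \<in> B i \<Longrightarrow> y' \<in> B i \<Longrightarrow> \<bar>k x y - k x y'\<bar> \<le> e"
proof -
  \<comment> \<open>Here \<open>L\<close> is the compact parameter set and the point of
    \<open>K\<close> varies, so the arguments are swapped; symmetry restores them at the end. Two
    comparisons with the centre of a neighbourhood cost \<open>e / 2\<close> each.\<close>
  have "\<exists>V. y \<in> V \<and> open V \<and> (\<forall>y'\<in>V. \<forall>x\<in>L. \<bar>k y' x - k y x\<bar> \<le> e / 2)" for y
    using continuous_kernel_nbhd[OF k L half_gt_zero[OF e], of y] by metis
  then obtain V where V: "\<And>y. y \<in> V y" "\<And>y. open (V y)"
    "\<And>x y y'. y' \<in> V y \<Longrightarrow> x \<in> L \<Longrightarrow> \<bar>k y' x - k y x\<bar> \<le> e / 2" by metis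
  obtain D where D: "D \<subseteq> K" "finite D" "K \<subseteq> (\<Union>y\<in>D. V y)"
    using compactE_image[OF K, of K V] V by blast
  obtain h where h: "bij_betw h {0..<card D} D" using ex_bij_betw_nat_finite[OF D(2)] by blast
  have cover: "K \<subseteq> (\<Union>i\<in>{0..<card D}. V (h i))"
  proof
    fix y assume "y \<in> K"
    then obtain d where d: "d \<in> D" "y \<in> V d" using D(3) by auto
    obtain i where "i \<in> {0..<card D}" "d = h i" using bij_betw_imp_surj_on[OF h] d(1) by (metis imageE)
    then show "y \<in> (\<Union>i\<in>{0..<card D}. V (h i))" using d(2) by auto
  qed
  \<comment> \<open>For \<open>i\<close> from \<open>card D\<close> on, \<open>h i\<close> is
    arbitrary, but the earlier sets already cover \<open>K\<close>, so \<open>disjointed A i\<close>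
    is empty.\<close>
  define A where "A i = K \<inter> V (h i)" for i
  have "K \<in> sets borel" using K by (simp add: borel_compact)
  then have A: "A i \<in> sets borel" for i using V(2) by (auto simp: A_def)
  show ?thesis
  proof (rule that[of "disjointed A" "card D"])
    show "disjoint_family (disjointed A)" by (rule disjoint_family_disjointed)
    show "disjointed A i \<in> sets borel" for i using A by (auto simp: disjointed_def)
    show "(\<Union>i<card D. disjointed A i) = K"
      using finite_UN_disjointed_eq[of A "card D"] cover
      by (auto simp: A_def lessThan_atLeast0)
    fix i x y y' assume "x \<in> L" "y \<in> disjointed A i" "y' \<in> disjointed A i"
    then have "\<bar>k y x - k (h i) x\<bar> \<le> e / 2" "\<bar>k y' x - k (h i) x\<bar> \<le> e / 2"
      using V(3) disjointed_subset[of A i] by (auto simp: A_def)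
    then show "\<bar>k x y - k x y'\<bar> \<le> e"
      unfolding continuous_kernel_sym[OF k, of x y] continuous_kernel_sym[OF k, of x y'] by linarith
  qed
qed

lemma integrable_kernel_compact:
  fixes k :: "'a::t2_space \<Rightarrow> 'a \<Rightarrow> real"
  assumes k: "continuous_kernel k" and "finite_measure \<mu>" and sets: "sets \<mu> = sets borel"
    and K: "compact K"
  shows "integrable \<mu> (\<lambda>y. indicator K y * k x y)"
proof -
  interpret finite_measure \<mu> by fact
  obtain M where M: "0 \<le> M" "\<And>y. y \<in> K \<Longrightarrow> \<bar>k x y\<bar> \<le> M"
    using continuous_kernel_bounded[OF k compact_sing[of x] K] by (metis singletonI)
  note [measurable] = continuous_kernel_measurable[OF k] borel_compact[OF K]
  have "(\<lambda>y. indicator K y * k x y) \<in> borel_measurable borel" by measurable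
  then show ?thesis
    using M sets by (intro integrable_const_bound[where B = M]) (auto simp: indicator_def cong: measurable_cong_sets)
qed

text \<open>Half of \<open>e\<close> pays for replacing the kernel by a step function on the
  partition, the other half for rounding the normalised masses of the pieces. Neither the pieces nor
  the points depend on \<open>x\<close>.\<close>

lemma normalized_integral_approx:
  fixes k :: "'a::t2_space \<Rightarrow> 'a \<Rightarrow> real"
  assumes k: "continuous_kernel k" and \<mu>: "finite_measure \<mu>" and sets: "sets \<mu> = sets borel"
    and K: "compact K" and L: "compact L" and pos: "0 < measure \<mu> K"
    and H: "outer_measure_of \<mu> (K - H) = 0" and e: "0 < e"
  obtains n :: nat and w where "1 \<le> n" "\<And>j. j \<in> {1..n} \<Longrightarrow> w j \<in> H"
    "\<And>x. x \<in> L \<Longrightarrow> \<bar>1 / real n * (\<Sum>j=1..n. k x (w j))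
        - (\<integral>y. indicator K y * k x y \<partial>\<mu>) / measure \<mu> K\<bar> \<le> e"
proof -
  interpret finite_measure \<mu> by fact
  obtain N :: nat and B where B: "disjoint_family B" "(\<Union>i<N. B i) = K" "\<And>i. B i \<in> sets borel"
    "\<And>i x y y'. x \<in> L \<Longrightarrow> y \<in> B i \<Longrightarrow> y' \<in> B i \<Longrightarrow> \<bar>k x y - k x y'\<bar> \<le> e / 2"
    by (rule small_oscillation_partition[OF k K L half_gt_zero[OF e]]) (rule that)
  have BM[measurable]: "B i \<in> sets \<mu>" for i using B(3) sets by simp
  have KM[measurable]: "K \<in> sets \<mu>" using K sets by (simp add: borel_compact)
  \<comment> \<open>A piece missing \<open>H\<close> lies in \<open>K - H\<close> and is null by
    monotonicity of the outer measure, so \<open>H\<close> itself need not be Borel. Null nonempty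
    pieces still receive a point, which makes the step function below accurate on all of
    \<open>K\<close>.\<close>
  have "\<exists>p. (B i \<noteq> {} \<longrightarrow> p \<in> B i) \<and> (0 < measure \<mu> (B i) \<longrightarrow> p \<in> H)" if "i < N" for i
  proof (cases "B i \<inter> H = {}")
    case True
    then have "B i \<subseteq> K - H" using B(2) that by auto
    then have "emeasure \<mu> (B i) \<le> 0"
      using outer_measure_of_mono[of "B i" "K - H" \<mu>] H BM by simp
    then show ?thesis by (auto simp: measure_def)
  qed auto
  then obtain p where p: "\<And>i. i < N \<Longrightarrow> B i \<noteq> {} \<Longrightarrow> p i \<in> B i"
    "\<And>i. i < N \<Longrightarrow> 0 < measure \<mu> (B i) \<Longrightarrow> p i \<in> H" by metis
  \<comment> \<open>Only these pieces are known to have their point in \<open>H\<close>; the others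
    contribute nothing to weighted sums.\<close>
  define I where "I = {i\<in>{..<N}. 0 < measure \<mu> (B i)}"
  have sum_I: "(\<Sum>i\<in>I. measure \<mu> (B i) * f i) = (\<Sum>i<N. measure \<mu> (B i) * f i)" for f
    unfolding I_def by (rule sum.mono_neutral_left) (auto simp: less_le)
  have "measure \<mu> (\<Union>i<N. B i) = (\<Sum>i<N. measure \<mu> (B i))"
    using B(1) by (intro finite_measure_finite_Union) (auto simp: disjoint_family_on_def)
  then have sum_K: "(\<Sum>i<N. measure \<mu> (B i)) = measure \<mu> K" by (simp add: B(2))
  have pI: "p i \<in> K" if "i \<in> I" for i
  proof -
    have "B i \<noteq> {}" using that by (auto simp: I_def)
    then show ?thesis using p(1)[of i] that B(2) by (auto simp: I_def)
  qed
  obtain M where M: "0 \<le> M" "\<And>x y. x \<in> L \<Longrightarrow> y \<in> K \<Longrightarrow> \<bar>k x y\<bar> \<le> M"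
    using continuous_kernel_bounded[OF k L K] by metis
  have w1: "finite I" by (simp add: I_def)
  have w2: "(\<Sum>i\<in>I. measure \<mu> (B i) / measure \<mu> K) = 1"
    using sum_I[of "\<lambda>_. 1"] sum_K pos by (simp flip: sum_divide_distrib)
  obtain n :: nat and g where g: "1 \<le> n" "\<And>j. j \<in> {1..n} \<Longrightarrow> g j \<in> I"
    "\<And>f :: nat \<Rightarrow> real. (\<And>i. i \<in> I \<Longrightarrow> \<bar>f i\<bar> \<le> M) \<Longrightarrow>
       \<bar>1 / real n * (\<Sum>j=1..n. f (g j)) - (\<Sum>i\<in>I. measure \<mu> (B i) / measure \<mu> K * f i)\<bar> \<le> e / 2"
    by (rule weighted_average_approx[OF w1 _ w2 half_gt_zero[OF e] M(1)]) (auto)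
  show ?thesis
  proof (rule that[of n "\<lambda>j. p (g j)", OF g(1)])
    show "p (g j) \<in> H" if "j \<in> {1..n}" for j using p(2) g(2)[OF that] by (auto simp: I_def)
    fix x assume x: "x \<in> L"
    define s where "s y = (\<Sum>i<N. indicator (B i) y * k x (p i))" for y
    have s_int: "integrable \<mu> s"
      unfolding s_def
      by (intro Bochner_Integration.integrable_sum integrable_mult_left integrable_real_indicator BM)
        (simp add: emeasure_eq_measure)
    have s_val: "(\<integral>y. s y \<partial>\<mu>) = (\<Sum>i<N. measure \<mu> (B i) * k x (p i))"
      unfolding s_def by (subst Bochner_Integration.integral_sum)
        (auto simp: emeasure_eq_measure sets.Int_space_eq2)
    have s_le: "\<bar>indicator K y * k x y - s y\<bar> \<le> e / 2 * indicator K y" for y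
    proof (cases "y \<in> K")
      case True
      then obtain i where i: "i < N" "y \<in> B i" using B(2) by auto
      have "s y = (\<Sum>l<N. if l = i then k x (p i) else 0)"
        unfolding s_def using i B(1) by (intro sum.cong) (auto simp: disjoint_family_on_def indicator_def)
      then have "s y = k x (p i)" using i by simp
      moreover have "p i \<in> B i" using p(1)[of i] i by auto
      ultimately show ?thesis using True B(4)[OF x i(2)] by simp
    next
      case False
      then have "s y = 0" unfolding s_def using B(2) by (intro sum.neutral) auto
      then show ?thesis using False by simp
    qed
    let ?J = "\<integral>y. indicator K y * k x y \<partial>\<mu>"
    have k_int: "integrable \<mu> (\<lambda>y. indicator K y * k x y)"
      by (rule integrable_kernel_compact[OF k \<mu> sets K])
    have "\<bar>?J - (\<integral>y. s y \<partial>\<mu>)\<bar> = \<bar>\<integral>y. indicator K y * k x y - s y \<partial>\<mu>\<bar>"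
      using k_int s_int by simp
    also have "\<dots> \<le> (\<integral>y. \<bar>indicator K y * k x y - s y\<bar> \<partial>\<mu>)" by (rule integral_abs_bound)
    also have "\<dots> \<le> (\<integral>y. e / 2 * indicator K y \<partial>\<mu>)"
      using k_int s_int s_le by (intro integral_mono) (auto intro!: integrable_real_indicator simp: emeasure_eq_measure)
    also have "\<dots> = e / 2 * measure \<mu> K" by (simp add: sets.Int_space_eq2)
    finally have "\<bar>?J - (\<integral>y. s y \<partial>\<mu>)\<bar> / measure \<mu> K \<le> e / 2" using pos by (simp add: field_simps)
    then have "\<bar>?J / measure \<mu> K - (\<integral>y. s y \<partial>\<mu>) / measure \<mu> K\<bar> \<le> e / 2"
      using pos by (simp flip: diff_divide_distrib)
    moreover have "(\<integral>y. s y \<partial>\<mu>) / measure \<mu> K = (\<Sum>i\<in>I. measure \<mu> (B i) / measure \<mu> K * k x (p i))"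
      unfolding s_val sum_I[symmetric] by (simp add: sum_divide_distrib)
    moreover have "\<bar>1 / real n * (\<Sum>j=1..n. k x (p (g j))) - (\<Sum>i\<in>I. measure \<mu> (B i) / measure \<mu> K * k x (p i))\<bar> \<le> e / 2"
      by (rule g(3)) (use M(2)[OF x] pI in auto)
    ultimately show "\<bar>1 / real n * (\<Sum>j=1..n. k x (p (g j))) - ?J / measure \<mu> K\<bar> \<le> e"
      by linarith
  qed
qed

section \<open>Potentials of regular measures\<close>

text \<open>Inner regularity of the whole space gives compact sets of measure above
  \<open>1 - 1 / (n + 1)\<close>; finite unions make them increase.\<close>

lemma regular_borel_prob_compact_exhaustion:
  fixes \<mu> :: "'a::t2_space measure"
  assumes "regular_borel_prob \<mu>"
  obtains K :: "nat \<Rightarrow> 'a set" where "\<And>n. compact (K n)" "incseq K" "AE y in \<mu>. y \<in> (\<Union>n. K n)"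
    "(\<lambda>n. measure \<mu> (K n)) \<longlonglongrightarrow> 1"
proof -
  have sets: "sets \<mu> = sets borel" and "prob_space \<mu>"
    and inner: "\<And>B. B \<in> sets \<mu> \<Longrightarrow> emeasure \<mu> B = (SUP K\<in>{K. compact K \<and> K \<subseteq> B}. emeasure \<mu> K)"
    using assms by (auto simp: regular_borel_prob_def)
  interpret prob_space \<mu> by fact
  have "\<exists>C. compact C \<and> 1 - 1 / real (Suc n) < measure \<mu> C" for n
  proof -
    have "ennreal (1 - 1 / real (Suc n)) < emeasure \<mu> (space \<mu>)"
      by (simp add: emeasure_space_1 ennreal_less_one_iff)
    also have "emeasure \<mu> (space \<mu>) = (SUP K\<in>{K. compact K \<and> K \<subseteq> space \<mu>}. emeasure \<mu> K)"
      by (rule inner) simp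
    finally obtain C where "compact C" "ennreal (1 - 1 / real (Suc n)) < emeasure \<mu> C"
      by (auto simp: less_SUP_iff)
    then show ?thesis by (auto simp: emeasure_eq_measure ennreal_less_iff)
  qed
  then obtain C where C: "\<And>n. compact (C n)" "\<And>n. 1 - 1 / real (Suc n) < measure \<mu> (C n)" by metis
  define K where "K n = (\<Union>i\<le>n. C i)" for n
  have cK: "compact (K n)" for n unfolding K_def using C(1) by (intro compact_UN) auto
  then have KM[measurable]: "K n \<in> sets \<mu>" for n using sets by (simp add: borel_compact)
  have inc: "incseq K" unfolding K_def incseq_def by (auto intro: order_trans)
  have lb: "1 - 1 / real (Suc n) \<le> measure \<mu> (K n)" for n
  proof -
    have "measure \<mu> (C n) \<le> measure \<mu> (K n)"
      by (rule finite_measure_mono[OF _ KM]) (auto simp: K_def)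
    then show ?thesis using C(2)[of n] by simp
  qed
  have lim: "(\<lambda>n. measure \<mu> (K n)) \<longlonglongrightarrow> 1"
  proof (rule tendsto_sandwich)
    show "(\<lambda>n. 1 - 1 / real (Suc n)) \<longlonglongrightarrow> 1"
      using tendsto_diff[OF tendsto_const[of 1] LIMSEQ_inverse_real_of_nat] by (simp add: divide_inverse)
  qed (use lb prob_le_1 in auto)
  have "(\<lambda>n. measure \<mu> (K n)) \<longlonglongrightarrow> measure \<mu> (\<Union>n. K n)"
    using inc by (intro finite_Lim_measure_incseq) auto
  then have "prob (\<Union>n. K n) = 1" using lim LIMSEQ_unique by blast
  then have "AE y in \<mu>. y \<in> (\<Union>n. K n)" using AE_in_set_eq_1[of "\<Union>n. K n"] by simp
  then show ?thesis using that cK inc lim by blast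
qed

text \<open>Monotone convergence expresses a possibly infinite potential through finite real
  integrals.\<close>

lemma potential_eq_SUP_compact:
  fixes k :: "'a::t2_space \<Rightarrow> 'a \<Rightarrow> real"
  assumes k: "continuous_kernel k" and \<mu>: "finite_measure \<mu>" and sets: "sets \<mu> = sets borel"
    and K: "\<And>n. compact (K n)" "incseq K" "AE y in \<mu>. y \<in> (\<Union>n. K n)"
  shows "potential k \<mu> x = (SUP n. ennreal (\<integral>y. indicator (K n) y * k x y \<partial>\<mu>))"
proof -
  note [measurable_cong] = sets
  note [measurable] = continuous_kernel_measurable[OF k] borel_compact[OF K(1)]
  have "potential k \<mu> x = (\<integral>\<^sup>+ y. (SUP n. ennreal (indicator (K n) y * k x y)) \<partial>\<mu>)"
    unfolding potential_def
  proof (rule nn_integral_cong_AE, use K(3) in eventually_elim)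
    case (elim y)
    then obtain m where m: "y \<in> K m" by auto
    have "(SUP n. ennreal (indicator (K n) y * k x y)) = ennreal (k x y)"
    proof (rule antisym)
      have "ennreal (indicator (K m) y * k x y) \<le> (SUP n. ennreal (indicator (K n) y * k x y))"
        by (rule SUP_upper) simp
      then show "ennreal (k x y) \<le> (SUP n. ennreal (indicator (K n) y * k x y))" using m by simp
    qed (auto intro!: SUP_least simp: indicator_def)
    then show ?case by simp
  qed
  also have "\<dots> = (SUP n. \<integral>\<^sup>+ y. ennreal (indicator (K n) y * k x y) \<partial>\<mu>)"
    using K(2) continuous_kernel_nonneg[OF k]
    by (intro nn_integral_monotone_convergence_SUP)
      (auto simp: incseq_def le_fun_def indicator_def intro!: ennreal_leI)
  also have "\<dots> = (SUP n. ennreal (\<integral>y. indicator (K n) y * k x y \<partial>\<mu>))"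
    using integrable_kernel_compact[OF k \<mu> sets K(1)] continuous_kernel_nonneg[OF k]
    by (subst nn_integral_eq_integral) auto
  finally show ?thesis .
qed

section \<open>Transferring one-sided bounds from potentials to finite averages\<close>

text \<open>A Dini-type argument: the truncated potentials \<open>J n\<close> increase in
  \<open>n\<close>, each exceeds \<open>c'\<close> at its point for some \<open>n\<close>, and by
  continuity nearly so on a neighbourhood; compactness of \<open>L\<close> then provides one index
  for all points.\<close>

lemma average_lower_bound:
  fixes k :: "'a::t2_space \<Rightarrow> 'a \<Rightarrow> real"
  assumes k: "continuous_kernel k" and L: "compact L" and \<mu>: "\<mu> \<in> prob_measures_on H"
    and c: "c < c'" and less: "\<And>x. x \<in> L \<Longrightarrow> ennreal c' < potential k \<mu> x"
  obtains n :: nat and w where "1 \<le> n" "\<And>j. j \<in> {1..n} \<Longrightarrow> w j \<in> H"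
    "\<And>x. x \<in> L \<Longrightarrow> c \<le> 1 / real n * (\<Sum>j=1..n. k x (w j))"
proof -
  have reg: "regular_borel_prob \<mu>" and conc: "concentrated_on \<mu> H"
    using \<mu> by (auto simp: prob_measures_on_def)
  then have sets: "sets \<mu> = sets borel" and "prob_space \<mu>" by (auto simp: regular_borel_prob_def)
  interpret prob_space \<mu> by fact
  have fin: "finite_measure \<mu>" by (rule finite_measure_axioms)
  obtain K where K: "\<And>n. compact (K n)" "incseq K" "AE y in \<mu>. y \<in> (\<Union>n. K n)"
    "(\<lambda>n. measure \<mu> (K n)) \<longlonglongrightarrow> 1"
    using regular_borel_prob_compact_exhaustion[OF reg] by blast
  define J where "J n x = (\<integral>y. indicator (K n) y * k x y \<partial>\<mu>)" for n x
  have int: "integrable \<mu> (\<lambda>y. indicator (K n) y * k x y)" for n x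
    by (rule integrable_kernel_compact[OF k fin sets K(1)])
  have KM[measurable]: "K n \<in> sets \<mu>" for n using K(1) sets by (simp add: borel_compact)
  have J_nonneg: "0 \<le> J n x" for n x
    unfolding J_def using continuous_kernel_nonneg[OF k] by (intro integral_nonneg_AE) auto
  have J_mono: "J m x \<le> J n x" if "m \<le> n" for m n x
    unfolding J_def using incseqD[OF K(2) that] continuous_kernel_nonneg[OF k]
    by (intro integral_mono int) (auto simp: indicator_def)
  \<comment> \<open>One \<open>e\<close> is lost on the neighbourhoods, the other in passing to an
    average.\<close>
  define e where "e = (c' - c) / 2"
  have e: "0 < e" using c by (simp add: e_def)
  have "\<exists>n V. x \<in> V \<and> open V \<and> (\<forall>x'\<in>V. c' - e \<le> J n x')" if x: "x \<in> L" for x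
  proof -
    have "ennreal c' < (SUP n. ennreal (J n x))"
      using less[OF x] potential_eq_SUP_compact[OF k fin sets K(1-3)] by (simp add: J_def)
    then obtain n where "ennreal c' < ennreal (J n x)" by (auto simp: less_SUP_iff)
    then have n: "c' < J n x" using J_nonneg ennreal_leI not_less by metis
    obtain V where V: "x \<in> V" "open V" "\<And>x' y. x' \<in> V \<Longrightarrow> y \<in> K n \<Longrightarrow> \<bar>k x' y - k x y\<bar> \<le> e"
      using continuous_kernel_nbhd[OF k K(1) e] by blast
    have "c' - e \<le> J n x'" if "x' \<in> V" for x'
    proof -
      have "J n x - e * measure \<mu> (K n) = (\<integral>y. indicator (K n) y * k x y - e * indicator (K n) y \<partial>\<mu>)"
        using int unfolding J_def
        by (subst Bochner_Integration.integral_diff)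
          (auto intro!: integrable_real_indicator simp: emeasure_eq_measure sets.Int_space_eq2)
      also have "\<dots> \<le> J n x'"
        unfolding J_def
      proof (intro integral_mono int Bochner_Integration.integrable_diff)
        show "integrable \<mu> (\<lambda>y. e * indicator (K n) y)"
          by (auto intro!: integrable_real_indicator simp: emeasure_eq_measure)
        show "indicator (K n) y * k x y - e * indicator (K n) y \<le> indicator (K n) y * k x' y" for y
          using V(3)[OF that, of y] by (cases "y \<in> K n") auto
      qed
      finally have "J n x - e * measure \<mu> (K n) \<le> J n x'" .
      moreover have "e * measure \<mu> (K n) \<le> e" using e prob_le_1 by (simp add: mult_left_le)
      ultimately show ?thesis using n by linarith
    qed
    then show ?thesis using V by blast
  qed
  then obtain N V where NV: "\<And>x. x \<in> L \<Longrightarrow> x \<in> V x" "\<And>x. x \<in> L \<Longrightarrow> open (V x)"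
    "\<And>x x'. x \<in> L \<Longrightarrow> x' \<in> V x \<Longrightarrow> c' - e \<le> J (N x) x'" by metis
  obtain D where D: "D \<subseteq> L" "finite D" "L \<subseteq> (\<Union>x\<in>D. V x)"
    using compactE_image[OF L, of L V] NV by blast
  have "eventually (\<lambda>n. 0 < measure \<mu> (K n)) sequentially"
    using order_tendstoD(1)[OF K(4), of 0] by simp
  moreover have "eventually (\<lambda>n. \<forall>x\<in>D. N x \<le> n) sequentially"
    using D(2) by (auto simp: eventually_ball_finite_distrib eventually_ge_at_top)
  ultimately obtain m where m: "0 < measure \<mu> (K m)" "\<And>x. x \<in> D \<Longrightarrow> N x \<le> m"
    using eventually_happens[OF eventually_conj] by fastforce
  have J_ge: "c' - e \<le> J m x / measure \<mu> (K m)" if x: "x \<in> L" for x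
  proof -
    obtain x0 where x0: "x0 \<in> D" "x \<in> V x0" using D(3) x by auto
    then have "c' - e \<le> J (N x0) x" using NV(3) D(1) by blast
    also have "\<dots> \<le> J m x" using m(2) x0 by (intro J_mono) auto
    \<comment> \<open>Dividing a nonnegative number by a mass at most 1 can only increase
      it.\<close>
    also have "\<dots> \<le> J m x / measure \<mu> (K m)"
      using m(1) prob_le_1[of "K m"] J_nonneg[of m x] by (simp add: pos_le_divide_eq mult_left_le)
    finally show ?thesis .
  qed
  obtain n :: nat and w where w: "1 \<le> n" "\<And>j. j \<in> {1..n} \<Longrightarrow> w j \<in> H"
    "\<And>x. x \<in> L \<Longrightarrow> \<bar>1 / real n * (\<Sum>j=1..n. k x (w j)) - J m x / measure \<mu> (K m)\<bar> \<le> e"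
    unfolding J_def
    by (rule normalized_integral_approx[OF k fin sets K(1) L m(1) _ e])
      (use conc K(1) in \<open>auto simp: concentrated_on_def\<close>)
  show ?thesis
  proof (rule that[OF w(1,2)])
    show "c \<le> 1 / real n * (\<Sum>j=1..n. k x (w j))" if "x \<in> L" for x
      using w(3)[OF that] J_ge[OF that] unfolding e_def by argo
  qed
qed

text \<open>Truncation lowers the potential at all points at once, so no covering argument is
  required to bound \<open>J m\<close>; only the factor \<open>1 / measure \<mu> (K m)\<close> must
  be kept close to 1.\<close>

lemma average_upper_bound:
  fixes k :: "'a::t2_space \<Rightarrow> 'a \<Rightarrow> real"
  assumes k: "continuous_kernel k" and L: "compact L" and \<mu>: "\<mu> \<in> prob_measures_on H"
    and c: "0 \<le> c" "c < c'" and less: "\<And>x. x \<in> L \<Longrightarrow> potential k \<mu> x \<le> ennreal c"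
  obtains n :: nat and w where "1 \<le> n" "\<And>j. j \<in> {1..n} \<Longrightarrow> w j \<in> H"
    "\<And>x. x \<in> L \<Longrightarrow> 1 / real n * (\<Sum>j=1..n. k x (w j)) \<le> c'"
proof -
  have reg: "regular_borel_prob \<mu>" and conc: "concentrated_on \<mu> H"
    using \<mu> by (auto simp: prob_measures_on_def)
  then have sets: "sets \<mu> = sets borel" and "prob_space \<mu>" by (auto simp: regular_borel_prob_def)
  interpret prob_space \<mu> by fact
  have fin: "finite_measure \<mu>" by (rule finite_measure_axioms)
  obtain K where K: "\<And>n. compact (K n)" "incseq K" "AE y in \<mu>. y \<in> (\<Union>n. K n)"
    "(\<lambda>n. measure \<mu> (K n)) \<longlonglongrightarrow> 1"
    using regular_borel_prob_compact_exhaustion[OF reg] by blast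
  define J where "J n x = (\<integral>y. indicator (K n) y * k x y \<partial>\<mu>)" for n x
  \<comment> \<open>The gap from \<open>c\<close> to \<open>d\<close> absorbs the normalisation,
    that from \<open>d\<close> to \<open>c'\<close> the averaging error.\<close>
  define d where "d = (c + c') / 2"
  have d: "c < d" "0 < d" "0 < c' - d" using c by (auto simp: d_def)
  then have "c / d < 1" by simp
  then obtain m where m: "c / d < measure \<mu> (K m)"
    using eventually_happens[OF order_tendstoD(1)[OF K(4)]] by force
  have m0: "0 < measure \<mu> (K m)" using m c d by (auto intro: le_less_trans[rotated])
  have J_le: "J m x / measure \<mu> (K m) \<le> d" if x: "x \<in> L" for x
  proof -
    have "ennreal (J m x) \<le> (SUP n. ennreal (J n x))" by (rule SUP_upper) simp
    also have "\<dots> \<le> ennreal c"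
      using less[OF x] potential_eq_SUP_compact[OF k fin sets K(1-3)] by (simp add: J_def)
    finally have "J m x \<le> c" using c by (simp add: ennreal_le_iff)
    also have "\<dots> \<le> d * measure \<mu> (K m)" using m d by (simp add: field_simps)
    finally show ?thesis using m0 by (simp add: pos_divide_le_eq)
  qed
  obtain n :: nat and w where w: "1 \<le> n" "\<And>j. j \<in> {1..n} \<Longrightarrow> w j \<in> H"
    "\<And>x. x \<in> L \<Longrightarrow> \<bar>1 / real n * (\<Sum>j=1..n. k x (w j)) - J m x / measure \<mu> (K m)\<bar> \<le> c' - d"
    unfolding J_def
    by (rule normalized_integral_approx[OF k fin sets K(1) L m0 _ d(3)])
      (use conc K(1) in \<open>auto simp: concentrated_on_def\<close>)
  show ?thesis
  proof (rule that[OF w(1,2)])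
    show "1 / real n * (\<Sum>j=1..n. k x (w j)) \<le> c'" if "x \<in> L" for x
      using w(3)[OF that] J_le[OF that] by argo
  qed
qed

section \<open>From averages back to arbitrary measures\<close>

text \<open>Concentration on the empty set would make every compact set null, against the exhaustion
  by compact sets with mass tending to 1.\<close>

lemma prob_measures_on_empty: "prob_measures_on {} = ({} :: 'a::t2_space measure set)"
proof (rule ccontr)
  assume "prob_measures_on {} \<noteq> ({} :: 'a measure set)"
  then obtain \<mu> :: "'a measure" where reg: "regular_borel_prob \<mu>" and "concentrated_on \<mu> {}"
    by (auto simp: prob_measures_on_def)
  moreover have "sets \<mu> = sets borel" using reg by (simp add: regular_borel_prob_def)
  ultimately have "measure \<mu> K = 0" if "compact K" for K
    using that by (simp add: concentrated_on_def borel_compact measure_def)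
  moreover obtain K :: "nat \<Rightarrow> 'a set" where "\<And>n. compact (K n)" "(\<lambda>n. measure \<mu> (K n)) \<longlonglongrightarrow> 1"
    by (rule regular_borel_prob_compact_exhaustion[OF reg]) blast
  ultimately show False by (simp add: LIMSEQ_const_iff)
qed

lemma R_set_subset_A_set:
  fixes k :: "'a::t2_space \<Rightarrow> 'a \<Rightarrow> real"
  assumes k: "continuous_kernel k" and L: "compact L"
  shows "R_set k H L \<subseteq> A_set k H L"
  unfolding A_set_def
proof (intro INT_greatest subsetI)
  fix \<mu> t assume \<mu>: "\<mu> \<in> prob_measures_on H" and t: "t \<in> R_set k H L"
  let ?avg = "\<lambda>n w x. ennreal (1 / real n * (\<Sum>j=1..n. k x (w j)))"
  have t_avg: "(INF x\<in>L. ?avg n w x) \<le> t" "t \<le> (SUP x\<in>L. ?avg n w x)"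
    if "1 \<le> n" "\<And>j. j \<in> {1..n} \<Longrightarrow> w j \<in> H" for n :: nat and w
  proof -
    have "t \<in> closed_conv (?avg n w ` L)"
      using t that unfolding R_set_def by (blast intro: atLeast_iff[THEN iffD2])
    then show "(INF x\<in>L. ?avg n w x) \<le> t" "t \<le> (SUP x\<in>L. ?avg n w x)"
      using closed_conv_subset_Inf_Sup by fastforce+
  qed
  have "H \<noteq> {}" using \<mu> prob_measures_on_empty by auto
  then obtain h where h: "h \<in> H" by auto
  \<comment> \<open>With \<open>L\<close> empty, the one-point average at \<open>h\<close> would
    force \<open>t\<close> to be at least top and at most bottom.\<close>
  have "L \<noteq> {}"
  proof
    assume "L = {}"
    then show False using t_avg[of 1 "\<lambda>_. h"] h by (auto simp: top_unique bot_ennreal)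
  qed
  have lower: "(INF x\<in>L. potential k \<mu> x) \<le> t"
  proof (rule ccontr)
    assume "\<not> ?thesis"
    \<comment> \<open>Two intermediate values leave room for the approximation error; being strictly
      below something, both are finite.\<close>
    then obtain u v where uv: "t < u" "u < v" "v < (INF x\<in>L. potential k \<mu> x)"
      by (meson dense not_le)
    obtain a b where ab: "u = ennreal a" "v = ennreal b" "0 \<le> a" "a < b"
      using uv by (cases u; cases v) (auto simp: ennreal_less_iff)
    have "ennreal b < potential k \<mu> x" if "x \<in> L" for x
      using uv(3) ab that by (meson INF_lower less_le_trans)
    then obtain n :: nat and w where w: "1 \<le> n" "\<And>j. j \<in> {1..n} \<Longrightarrow> w j \<in> H"
      "\<And>x. x \<in> L \<Longrightarrow> a \<le> 1 / real n * (\<Sum>j=1..n. k x (w j))"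
      using average_lower_bound[OF k L \<mu> ab(4)] by blast
    have "u \<le> (INF x\<in>L. ?avg n w x)" unfolding ab(1) using w(3) by (intro INF_greatest ennreal_leI)
    also have "\<dots> \<le> t" by (rule t_avg(1)[OF w(1,2)])
    finally show False using uv(1) by simp
  qed
  have upper: "t \<le> (SUP x\<in>L. potential k \<mu> x)"
  proof (rule ccontr)
    assume "\<not> ?thesis"
    then obtain u v where uv: "(SUP x\<in>L. potential k \<mu> x) < u" "u < v" "v < t"
      by (meson dense not_le)
    obtain a b where ab: "u = ennreal a" "v = ennreal b" "0 \<le> a" "a < b"
      using uv by (cases u; cases v) (auto simp: ennreal_less_iff)
    have "potential k \<mu> x \<le> ennreal a" if "x \<in> L" for x
      using uv(1) ab that by (meson SUP_upper less_imp_le le_less_trans)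
    then obtain n :: nat and w where w: "1 \<le> n" "\<And>j. j \<in> {1..n} \<Longrightarrow> w j \<in> H"
      "\<And>x. x \<in> L \<Longrightarrow> 1 / real n * (\<Sum>j=1..n. k x (w j)) \<le> b"
      using average_upper_bound[OF k L \<mu> ab(3,4)] by blast
    have "t \<le> (SUP x\<in>L. ?avg n w x)" by (rule t_avg(2)[OF w(1,2)])
    also have "\<dots> \<le> v" unfolding ab(2) using w(3) by (intro SUP_least ennreal_leI)
    finally show False using uv(3) by simp
  qed
  show "t \<in> closed_conv (potential k \<mu> ` L)"
    using lower upper \<open>L \<noteq> {}\<close> by (simp add: closed_conv_eq_Inf_Sup)
qed

theorem theorem6p9:
  fixes k :: "'a::t2_space \<Rightarrow> 'a \<Rightarrow> real" and L :: "'a set"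
  assumes "locally_compact_space (euclidean :: 'a topology)"
    and "continuous_kernel k"
    and "compact L"
  shows "\<forall>H. R_set k H L = A_set k H L"
  using A_set_subset_R_set R_set_subset_A_set assms by blast

end
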